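(* For every positive integer $n$ there exists a constant $c_n$ with $|c_n|\le 2$ such that $\gamma_{Zg}(P_n)=\frac{n}{2}+c_n$.
   Context: $P_n$ denotes the path graph on $n$ vertices. For a vertex $v$ of a graph $G$, $N(v)$ is its open neighborhood and $N[v]=N(v)\cup\{v\}$ its closed neighborhood. In the Z-domination game on a finite graph $G$ two players, Dominator and Staller, alternately select a vertex of $G$, with Dominator moving first. In the $i$-th move, after the moves $v_1,\dots,v_{i-1}$, the choice of a vertex $v_i$ is legal if $N(v_i)\setminus\bigcup_{j=1}^{i-1}N[v_j]\neq\emptyset$. The game ends when no legal move is available; its length is the total number of moves played. Dominator wants to minimize the length, Staller wants to maximize it. The number $\gamma_{Zg}(G)$ is the length of the game under optimal play by both players. *)

theory Defs
  imports Complex_Main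
begin

record 'a ugraph =
  verts :: "'a set"
  edges :: "'a set set"

definition simple_graph :: "'a ugraph \<Rightarrow> bool" where
  "simple_graph G \<longleftrightarrow> (\<forall>e\<in>edges G. e \<subseteq> verts G \<and> card e = 2)"

definition nbhd :: "'a ugraph \<Rightarrow> 'a \<Rightarrow> 'a set" where
  "nbhd G v = {u \<in> verts G. {u, v} \<in> edges G}"

definition closed_nbhd :: "'a ugraph \<Rightarrow> 'a \<Rightarrow> 'a set" where
  "closed_nbhd G v = insert v (nbhd G v)"

definition path_graph :: "nat \<Rightarrow> nat ugraph" where
  "path_graph n = \<lparr>verts = {1..n}, edges = {{i, i + 1} | i. 1 \<le> i \<and> i < n}\<rparr>"

lemma simple_graph_path_graph: "simple_graph (path_graph n)"
  by (auto simp: simple_graph_def path_graph_def)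

text \<open>A position of the game is the list of the moves played so far, in the order of play.\<close>

definition legal_moves :: "'a ugraph \<Rightarrow> 'a list \<Rightarrow> 'a set" where
  "legal_moves G vs =
     {v \<in> verts G. nbhd G v - (\<Union>w\<in>set vs. closed_nbhd G w) \<noteq> {}}"

text \<open>The total length of the game, counted from its very first move, when it has reached the
  position \<open>vs\<close> and both players play optimally from there on. Dominator moves first, so it is
  his turn exactly at the positions of even length. The finiteness guard only makes the recursion
  terminate; the value at infinite graphs is irrelevant.\<close>

function zgame_length :: "'a ugraph \<Rightarrow> 'a list \<Rightarrow> nat" where
  "zgame_length G vs =
     (if infinite (verts G) \<or> legal_moves G vs = {} then length vs
      else if even (length vs)
           then Min ((\<lambda>v. zgame_length G (vs @ [v])) ` legal_moves G vs)
           else Max ((\<lambda>v. zgame_length G (vs @ [v])) ` legal_moves G vs))"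
  by auto
termination
proof (relation "measure (\<lambda>(G, vs). card (verts G - (\<Union>w\<in>set vs. closed_nbhd G w)))",
       goal_cases)
  case 1
  then show ?case by simp
next
  have smaller: "card (verts G - (\<Union>w\<in>set (vs @ [v]). closed_nbhd G w))
      < card (verts G - (\<Union>w\<in>set vs. closed_nbhd G w))"
    if "finite (verts G)" and "v \<in> legal_moves G vs" for G :: "'a ugraph" and vs v
  proof (rule psubset_card_mono)
    from that(2) obtain u where "u \<in> nbhd G v" "u \<notin> (\<Union>w\<in>set vs. closed_nbhd G w)"
      by (auto simp: legal_moves_def)
    then show "verts G - (\<Union>w\<in>set (vs @ [v]). closed_nbhd G w)
        \<subset> verts G - (\<Union>w\<in>set vs. closed_nbhd G w)"
      by (auto simp: closed_nbhd_def nbhd_def)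
  qed (use that(1) in simp)
  {
    case (2 G vs v)
    then show ?case using smaller by auto
  next
    case (3 G vs v)
    then show ?case using smaller by auto
  }
qed

declare zgame_length.simps [simp del]

definition gamma_Zg :: "'a ugraph \<Rightarrow> nat" where
  "gamma_Zg G = zgame_length G []"

end

theory Submission imports Defs begin

text \<open>Let \<open>U\<close> be the set of undominated vertices. Dominator's moves remove at most three vertices
  from \<open>U\<close>. Every dominated vertex next to an undominated one was dominated from its other side, so
  playing it removes exactly one vertex; Staller can always do this after the first move. Hence
  \<open>n \<le> 2 * \<gamma> + 1\<close>.

  For the upper bound take as potential the size of \<open>U\<close> plus the number of its runs (maximal
  intervals). Every move lowers it by at least 1. While some run has length at least two, Dominator
  lowers it by 3 by playing the second vertex of such a run; once all runs are
  singletons, every move lowers it by at least 2. Starting from \<open>n + 1\<close>, this gives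
  \<open>2 * \<gamma> \<le> n + 1\<close>.\<close>

section \<open>Positions and game values on finite graphs\<close>

definition undominated :: "'a ugraph \<Rightarrow> 'a list \<Rightarrow> 'a set" where
  "undominated G vs = verts G - (\<Union>w\<in>set vs. closed_nbhd G w)"

lemma finite_undominated: "finite (verts G) \<Longrightarrow> finite (undominated G vs)"
  by (simp add: undominated_def)

lemma undominated_move: "w \<in> set vs \<Longrightarrow> w \<notin> undominated G vs"
  by (auto simp: undominated_def closed_nbhd_def)

lemma undominated_snoc: "undominated G (vs @ [v]) = undominated G vs - closed_nbhd G v"
  by (auto simp: undominated_def)

lemma legal_moves_iff:
  "v \<in> legal_moves G vs \<longleftrightarrow> v \<in> verts G \<and> nbhd G v \<inter> undominated G vs \<noteq> {}"
  by (auto simp: legal_moves_def undominated_def nbhd_def)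

text \<open>Each legal move dominates a new vertex, so the number of undominated vertices serves as
  measure. The hypothesis covers all successor positions, whoever is to move.\<close>

lemma game_induct [consumes 1, case_names pos]:
  assumes "finite (verts G)"
    and step: "\<And>vs. (\<And>v. v \<in> legal_moves G vs \<Longrightarrow> P (vs @ [v])) \<Longrightarrow> P vs"
  shows "P vs"
proof (induction "card (undominated G vs)" arbitrary: vs rule: less_induct)
  case less
  show ?case
  proof (rule step)
    fix v
    assume "v \<in> legal_moves G vs"
    then have "undominated G (vs @ [v]) \<subset> undominated G vs"
      by (auto simp: legal_moves_iff undominated_snoc closed_nbhd_def)
    then show "P (vs @ [v])"
      using less assms(1) by (simp add: finite_undominated psubset_card_mono)
  qed
qed

lemma zgame_length_terminal:
  "legal_moves G vs = {} \<Longrightarrow> zgame_length G vs = length vs"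
  by (simp add: zgame_length.simps)

context
  fixes G :: "'a ugraph"
  assumes fin: "finite (verts G)"
begin

lemma finite_legal_moves: "finite (legal_moves G vs)"
  using fin by (simp add: legal_moves_def)

text \<open>Minima and maxima over finite nonempty sets are attained. This supplies the optimal move
  of the player whose moves must all be accounted for.\<close>

lemma zgame_length_cases:
  assumes "legal_moves G vs \<noteq> {}"
  obtains v where "v \<in> legal_moves G vs" "zgame_length G vs = zgame_length G (vs @ [v])"
proof -
  let ?A = "(\<lambda>v. zgame_length G (vs @ [v])) ` legal_moves G vs"
  have "Min ?A \<in> ?A" "Max ?A \<in> ?A"
    using assms finite_legal_moves by (auto intro!: Min_in Max_in simp del: Min_in Max_in)
  then have "zgame_length G vs \<in> ?A"
    using assms fin zgame_length.simps[of G vs] by (simp split: if_splits)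
  then show ?thesis
    using that by auto
qed

lemma zgame_length_dominator:
  assumes "even (length vs)" "v \<in> legal_moves G vs"
  shows "zgame_length G vs \<le> zgame_length G (vs @ [v])"
  using assms fin finite_legal_moves zgame_length.simps[of G vs] by auto

lemma zgame_length_staller:
  assumes "odd (length vs)" "v \<in> legal_moves G vs"
  shows "zgame_length G (vs @ [v]) \<le> zgame_length G vs"
  using assms fin finite_legal_moves zgame_length.simps[of G vs] by auto

end

section \<open>Positions on paths\<close>

lemma verts_path_graph [simp]: "verts (path_graph n) = {1..n}"
  by (simp add: path_graph_def)

lemma nbhd_path_graph:
  "nbhd (path_graph n) v = {u. 1 \<le> u \<and> u \<le> n \<and> 1 \<le> v \<and> v \<le> n \<and> (u = Suc v \<or> v = Suc u)}"
  by (auto simp: nbhd_def path_graph_def doubleton_eq_iff)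

lemma closed_nbhd_path_graph:
  "v \<in> {1..n} \<Longrightarrow> closed_nbhd (path_graph n) v = {v - 1..Suc v} \<inter> {1..n}"
  by (auto simp: closed_nbhd_def nbhd_path_graph)

lemma undominated_path_snoc:
  assumes "v \<in> {1..n}"
  shows "undominated (path_graph n) (vs @ [v]) = undominated (path_graph n) vs - {v - 1..Suc v}"
  using assms by (auto simp: undominated_snoc closed_nbhd_path_graph undominated_def)

lemma undominated_path_subset: "undominated (path_graph n) vs \<subseteq> {1..n}"
  by (auto simp: undominated_def)

text \<open>The values \<open>v - 1 = 0\<close> and \<open>Suc v = n + 1\<close> are harmless:
  undominated vertices lie in \<open>{1..n}\<close>.\<close>

lemma legal_path_iff:
  "v \<in> legal_moves (path_graph n) vs \<longleftrightarrow> v \<in> {1..n} \<and>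
    (Suc v \<in> undominated (path_graph n) vs \<or> v - 1 \<in> undominated (path_graph n) vs)"
  using undominated_path_subset[of n vs]
  by (force simp: legal_moves_iff nbhd_path_graph)

text \<open>For \<open>n \<ge> 2\<close> every vertex has a neighbour, which may be played to
  dominate it.\<close>

lemma undominated_nonterminal:
  assumes "2 \<le> n" "undominated (path_graph n) vs \<noteq> {}"
  shows "legal_moves (path_graph n) vs \<noteq> {}"
proof -
  obtain u where u: "u \<in> undominated (path_graph n) vs"
    using assms by auto
  then have "u \<in> {1..n}"
    using undominated_path_subset by blast
  then have "u - 1 \<in> legal_moves (path_graph n) vs \<or> Suc u \<in> legal_moves (path_graph n) vs"
    using u \<open>2 \<le> n\<close> by (auto simp: legal_path_iff)
  then show ?thesis
    by auto
qed

section \<open>Lower bound: Staller's strategy\<close>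

lemma ex_step_in:
  fixes a b :: nat
  assumes "a \<le> b" "a \<notin> U" "b \<in> U"
  shows "\<exists>d. a \<le> d \<and> d < b \<and> d \<notin> U \<and> Suc d \<in> U"
  using assms by (induction rule: dec_induct) (auto intro: less_SucI)

lemma undominated_path_iff:
  assumes "set vs \<subseteq> {1..n}"
  shows "u \<in> undominated (path_graph n) vs \<longleftrightarrow> u \<in> {1..n} \<and> (\<forall>w\<in>set vs. u \<notin> {w - 1..Suc w})"
proof -
  have "closed_nbhd (path_graph n) w = {w - 1..Suc w} \<inter> {1..n}" if "w \<in> set vs" for w
    using that assms by (intro closed_nbhd_path_graph) blast
  then show ?thesis
    by (auto simp: undominated_def)
qed

text \<open>A move already played provides a dominated vertex. Between it and an undominated one
  there are adjacent \<open>d\<close> and \<open>e\<close> with only \<open>d\<close> dominated;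
  Staller plays \<open>d\<close>.\<close>

lemma staller_single_move:
  assumes vs: "set vs \<subseteq> {1..n}" "vs \<noteq> []" and "undominated (path_graph n) vs \<noteq> {}"
  obtains v where "v \<in> legal_moves (path_graph n) vs"
    "card (undominated (path_graph n) vs) \<le> Suc (card (undominated (path_graph n) (vs @ [v])))"
proof -
  let ?U = "undominated (path_graph n) vs"
  obtain u where u: "u \<in> ?U"
    using assms by auto
  obtain w where w: "w \<in> set vs"
    using vs(2) by (meson ex_in_conv set_empty)
  have wU: "w \<notin> ?U" "w \<in> {1..n}" "u \<in> {1..n}"
    using w vs u undominated_move[OF w] undominated_path_subset by blast+
  obtain d e where de: "d \<in> {1..n}" "d \<notin> ?U" "e \<in> ?U" "e = Suc d \<or> d = Suc e"
  proof (cases "w \<le> u")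
    case True
    then obtain d where "w \<le> d" "d < u" "d \<notin> ?U" "Suc d \<in> ?U"
      using ex_step_in[of w u ?U] wU u by blast
    then show ?thesis
      using that[of d "Suc d"] wU by auto
  next
    case False
    then obtain d where "u \<le> d" "d < w" "d \<in> ?U" "Suc d \<notin> ?U"
      \<comment> \<open>Passing to the complement finds the crossing in the opposite
        direction.\<close>
      using ex_step_in[of u w "- ?U"] wU u by auto
    then show ?thesis
      using that[of "Suc d" d] wU by auto
  qed
  obtain w' where w': "w' \<in> set vs" "d \<in> {w' - 1..Suc w'}"
    using de vs by (auto simp: undominated_path_iff)
  have "w' \<notin> ?U"
    using w'(1) by (rule undominated_move)
  moreover have "e \<notin> {w' - 1..Suc w'}"
    using w'(1) de(3) vs(1) by (auto simp: undominated_path_iff)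
  \<comment> \<open>The vertex \<open>w'\<close> dominating \<open>d\<close> does not dominate \<open>e\<close>, so it is the other neighbour of \<open>d\<close>.\<close>
  ultimately have "x = e" if "x \<in> ?U" "x \<in> {d - 1..Suc d}" for x
  proof -
    have "x = w' \<or> x = d \<or> x = e"
      using that \<open>e \<notin> {w' - 1..Suc w'}\<close> w'(2) de(4) by auto
    then show ?thesis
      using that \<open>w' \<notin> ?U\<close> de(2) by blast
  qed
  then have "?U \<subseteq> insert e (undominated (path_graph n) (vs @ [d]))"
    using de(1) by (auto simp: undominated_path_snoc)
  then have "card ?U \<le> card (insert e (undominated (path_graph n) (vs @ [d])))"
    by (intro card_mono) (auto simp: finite_undominated)
  also have "\<dots> \<le> Suc (card (undominated (path_graph n) (vs @ [d])))"
    by (simp add: finite_undominated card_insert_if)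
  finally have "card ?U \<le> Suc (card (undominated (path_graph n) (vs @ [d])))" .
  moreover have "d \<in> legal_moves (path_graph n) vs"
    using de by (auto simp: legal_path_iff)
  ultimately show ?thesis
    using that by blast
qed

lemma card_undominated_path_snoc:
  assumes "v \<in> {1..n}"
  shows "card (undominated (path_graph n) vs) \<le> card (undominated (path_graph n) (vs @ [v])) + 3"
proof -
  have "card (undominated (path_graph n) vs)
      \<le> card (undominated (path_graph n) (vs @ [v]) \<union> {v - 1..Suc v})"
    using assms by (intro card_mono) (auto simp: finite_undominated undominated_path_snoc)
  also have "\<dots> \<le> card (undominated (path_graph n) (vs @ [v])) + card {v - 1..Suc v}"
    by (rule card_Un_le)
  finally show ?thesis
    using assms by simp
qed

text \<open>Each move is credited with two vertices. Dominator may remove one more and Staller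
  removes at most one, so the two balance; the parity term is the surplus Dominator can still gain
  when on turn.\<close>

lemma zgame_length_path_lower:
  assumes "2 \<le> n" "set vs \<subseteq> {1..n}"
  shows "card (undominated (path_graph n) vs) + 2 * length vs
    \<le> 2 * zgame_length (path_graph n) vs + (if even (length vs) then 1 else 0)"
proof -
  have "finite (verts (path_graph n))"
    by simp
  then show ?thesis
    using assms(2)
  proof (induction vs rule: game_induct)
    case (pos vs)
    let ?G = "path_graph n"
    have IH: "card (undominated ?G (vs @ [v])) + 2 * length vs + 2
        \<le> 2 * zgame_length ?G (vs @ [v]) + (if even (length vs) then 0 else 1)"
      if "v \<in> legal_moves ?G vs" for v
      using pos.IH[OF that] pos.prems that by (auto simp: legal_moves_iff split: if_splits)
    consider "legal_moves ?G vs = {}" | "legal_moves ?G vs \<noteq> {}" "even (length vs)"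
      | "legal_moves ?G vs \<noteq> {}" "odd (length vs)"
      by blast
    then show ?case
    proof cases
      case 1
      then have "undominated ?G vs = {}"
        using undominated_nonterminal \<open>2 \<le> n\<close> by blast
      with 1 show ?thesis
        by (simp add: zgame_length_terminal)
    next
      case 2
      then obtain v where v: "v \<in> legal_moves ?G vs"
        and eq: "zgame_length ?G vs = zgame_length ?G (vs @ [v])"
        using zgame_length_cases[of ?G vs] by auto
      then show ?thesis
        using IH[OF v] 2 card_undominated_path_snoc[of v n vs] by (auto simp: legal_path_iff)
    next
      case 3
      then have "vs \<noteq> []" "undominated ?G vs \<noteq> {}"
        by (auto simp: legal_moves_iff)
      then obtain v where v: "v \<in> legal_moves ?G vs"
        "card (undominated ?G vs) \<le> Suc (card (undominated ?G (vs @ [v])))"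
        using staller_single_move pos.prems by metis
      then show ?thesis
        using IH[OF v(1)] 3 zgame_length_staller[of ?G vs v] by auto
    qed
  qed
qed

section \<open>Upper bound: the potential\<close>

text \<open>Each run is represented by its last element, so the cardinality counts runs.\<close>

definition run_ends :: "nat set \<Rightarrow> nat set" where
  "run_ends U = {i \<in> U. Suc i \<notin> U}"

definition potential :: "nat set \<Rightarrow> nat" where
  "potential U = card U + card (run_ends U)"

lemma finite_run_ends: "finite U \<Longrightarrow> finite (run_ends U)"
  by (simp add: run_ends_def)

lemma card_Diff_interval:
  fixes U :: "nat set"
  assumes "finite U"
  shows "card U = card (U - {a..b}) + card (U \<inter> {a..b})"
  using assms
  by (metis Int_Diff_Un Int_Diff_disjoint add.commute card_Un_disjoint finite_Diff finite_Int)

text \<open>Deleting an interval creates at most one new run end, just left of it. Two lost vertices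
  outweigh that; if only one is lost, the number of runs does not grow.\<close>

lemma potential_legal_move:
  fixes U :: "nat set"
  assumes "finite U" "0 \<notin> U" "Suc v \<in> U \<or> v - 1 \<in> U"
  shows "Suc (potential (U - {v - 1..Suc v})) \<le> potential U"
proof -
  let ?I = "{v - 1..Suc v}"
  let ?U' = "U - ?I"
  have fin: "finite (run_ends U)" "finite (run_ends ?U')"
    using assms by (auto simp: finite_run_ends)
  have cardU: "card U = card ?U' + card (U \<inter> ?I)"
    using assms(1) by (rule card_Diff_interval)
  \<comment> \<open>Legality puts a neighbour of \<open>v\<close> in \<open>U\<close>, so a vertex
    lost alone cannot be \<open>v\<close>.\<close>
  consider (pred) "U \<inter> ?I = {v - 1}" "v \<notin> U" | (suc) "U \<inter> ?I = {Suc v}"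
    | (more) "2 \<le> card (U \<inter> ?I)"
  proof (cases "card (U \<inter> ?I) \<le> 1")
    case True
    then obtain x where x: "U \<inter> ?I \<subseteq> {x}"
      using assms(1) card_le_Suc0_iff_eq[of "U \<inter> ?I"]
      by (metis One_nat_def finite_Int insertCI subsetI)
    show ?thesis
    proof (cases "Suc v \<in> U")
      case True
      then have "Suc v \<in> U \<inter> ?I"
        by auto
      then show ?thesis
        using x by (intro suc) blast
    next
      case False
      then have "v - 1 \<in> U \<inter> ?I" "v \<noteq> 0"
        using assms by (auto intro: gr0I)
      moreover have "v \<notin> U"
      proof
        assume "v \<in> U"
        then have "v \<in> U \<inter> ?I"
          by auto
        then have "v = v - 1"
          using x \<open>v - 1 \<in> U \<inter> ?I\<close> by blast
        then show False
          using \<open>v \<noteq> 0\<close> by simp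
      qed
      ultimately show ?thesis
        using x by (intro pred) blast+
    qed
  qed (use more in simp)
  then show ?thesis
  proof cases
    case pred
    have v1: "v - 1 \<in> run_ends U"
      using pred assms(2) by (cases v) (auto simp: run_ends_def)
    \<comment> \<open>The deleted end \<open>v - 1\<close> is at most replaced by
      \<open>v - 2\<close>.\<close>
    have "run_ends ?U' \<subseteq> insert (v - 2) (run_ends U - {v - 1})"
      by (auto simp: run_ends_def)
    then have "card (run_ends ?U') \<le> card (insert (v - 2) (run_ends U - {v - 1}))"
      using fin by (intro card_mono) auto
    also have "\<dots> \<le> Suc (card (run_ends U - {v - 1}))"
      by (simp add: card_insert_if fin)
    also have "\<dots> = card (run_ends U)"
      using fin(1) v1 by (rule card.remove[symmetric])
    finally show ?thesis
      using cardU pred by (simp add: potential_def)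
  next
    case suc
    have "run_ends ?U' \<subseteq> run_ends U"
    proof
      fix j
      assume j: "j \<in> run_ends ?U'"
      \<comment> \<open>A new end \<open>j\<close> would need \<open>Suc j\<close> deleted, forcing
        \<open>j = v\<close>, which is itself deleted.\<close>
      have "Suc j \<notin> U"
      proof
        assume "Suc j \<in> U"
        then have "Suc j \<in> U \<inter> ?I"
          using j by (auto simp: run_ends_def)
        then have "j = v"
          using suc by blast
        then show False
          using j by (auto simp: run_ends_def)
      qed
      then show "j \<in> run_ends U"
        using j by (auto simp: run_ends_def)
    qed
    then have "card (run_ends ?U') \<le> card (run_ends U)"
      using fin by (intro card_mono) auto
    then show ?thesis
      using cardU suc by (simp add: potential_def)
  next
    case more
    have "run_ends ?U' \<subseteq> insert (v - 2) (run_ends U)"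
      by (auto simp: run_ends_def)
    then have "card (run_ends ?U') \<le> card (insert (v - 2) (run_ends U))"
      using fin by (intro card_mono) auto
    also have "\<dots> \<le> Suc (card (run_ends U))"
      by (simp add: card_insert_if fin)
    finally show ?thesis
      using cardU more by (simp add: potential_def)
  qed
qed

text \<open>The deletion starts where a run starts, so no new run end arises. Either three vertices
  go, or the run has length two and disappears together with its end.\<close>

lemma potential_good_move:
  fixes U :: "nat set"
  assumes "finite U" "i \<in> U" "Suc i \<in> U" "i = 0 \<or> i - 1 \<notin> U"
  shows "potential (U - {i..Suc (Suc i)}) + 3 \<le> potential U"
proof -
  let ?I = "{i..Suc (Suc i)}"
  let ?U' = "U - ?I"
  have fin: "finite (run_ends U)"
    using assms by (simp add: finite_run_ends)
  have cardU: "card U = card ?U' + card (U \<inter> ?I)"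
    using assms(1) by (rule card_Diff_interval)
  have I: "?I = {i, Suc i, Suc (Suc i)}"
    by auto
  have sub: "run_ends ?U' \<subseteq> run_ends U - {Suc i}"
  proof
    fix j
    assume j: "j \<in> run_ends ?U'"
    have "Suc j \<noteq> i"
      using assms(4) j by (auto simp: run_ends_def)
    then show "j \<in> run_ends U - {Suc i}"
      using j by (auto simp: run_ends_def)
  qed
  show ?thesis
  proof (cases "Suc (Suc i) \<in> U")
    case True
    then have "U \<inter> ?I = ?I"
      using assms I by auto
    moreover have "card (run_ends ?U') \<le> card (run_ends U)"
      using fin sub by (intro card_mono) auto
    ultimately show ?thesis
      using cardU by (simp add: potential_def)
  next
    case False
    then have "U \<inter> ?I = {i, Suc i}" "Suc i \<in> run_ends U"
      using assms I by (auto simp: run_ends_def)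
    moreover from this have "card (run_ends ?U') < card (run_ends U)"
      using fin sub by (intro psubset_card_mono) auto
    ultimately show ?thesis
      using cardU by (simp add: potential_def)
  qed
qed

text \<open>Settles the phase in which all runs are singletons, where \<open>potential\<close> is
  twice the cardinality.\<close>

lemma zgame_length_le_card_undominated:
  assumes "finite (verts G)"
  shows "zgame_length G vs \<le> length vs + card (undominated G vs)"
  using assms
proof (induction vs rule: game_induct)
  case (pos vs)
  show ?case
  proof (cases "legal_moves G vs = {}")
    case False
    then obtain v where v: "v \<in> legal_moves G vs"
      and eq: "zgame_length G vs = zgame_length G (vs @ [v])"
      using zgame_length_cases assms by metis
    then have "undominated G (vs @ [v]) \<subset> undominated G vs"
      by (auto simp: legal_moves_iff undominated_snoc closed_nbhd_def)
    then have "card (undominated G (vs @ [v])) < card (undominated G vs)"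
      using assms by (simp add: finite_undominated psubset_card_mono)
    then show ?thesis
      using pos[OF v] eq by simp
  qed (simp add: zgame_length_terminal)
qed

text \<open>Each move should lower the potential by 2. Dominator's drop of 3 compensates for a drop
  of only 1 by Staller; the parity term is this surplus, held while Staller is on turn.\<close>

lemma zgame_length_path_upper:
  "2 * zgame_length (path_graph n) vs
    \<le> potential (undominated (path_graph n) vs) + 2 * length vs + (if even (length vs) then 0 else 1)"
proof -
  have "finite (verts (path_graph n))"
    by simp
  then show ?thesis
  proof (induction vs rule: game_induct)
    case (pos vs)
    let ?G = "path_graph n"
    let ?U = "undominated ?G vs"
    have fin: "finite ?U"
      by (simp add: finite_undominated)
    have zero: "0 \<notin> ?U"
      using undominated_path_subset[of n vs] by auto
    have IH: "2 * zgame_length ?G (vs @ [v])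
        \<le> potential (?U - {v - 1..Suc v}) + 2 * length vs + 2 + (if even (length vs) then 1 else 0)"
      if "v \<in> legal_moves ?G vs" for v
      using pos.IH[OF that] that by (auto simp: undominated_path_snoc legal_path_iff)
    consider (terminal) "legal_moves ?G vs = {}"
      | (isolated) "\<forall>i \<in> ?U. Suc i \<notin> ?U"
      | (dominator) "\<exists>i. i \<in> ?U \<and> Suc i \<in> ?U" "even (length vs)"
      | (staller) "legal_moves ?G vs \<noteq> {}" "odd (length vs)"
      by blast
    then show ?case
    proof cases
      case terminal
      then show ?thesis
        by (simp add: zgame_length_terminal)
    next
      case isolated
      then have "run_ends ?U = ?U"
        by (auto simp: run_ends_def)
      then show ?thesis
        using zgame_length_le_card_undominated[of ?G vs] by (simp add: potential_def)
    next
      case dominator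
      \<comment> \<open>The least such \<open>i\<close> starts its run, as \<open>i - 1\<close>
        would otherwise be a smaller choice. Dominator plays \<open>Suc i\<close>.\<close>
      define i where "i = (LEAST i. i \<in> ?U \<and> Suc i \<in> ?U)"
      have i: "i \<in> ?U" "Suc i \<in> ?U"
        using LeastI_ex[OF dominator(1)] by (auto simp: i_def)
      have "i - 1 \<notin> ?U"
      proof
        assume "i - 1 \<in> ?U"
        moreover have "i \<noteq> 0"
          using i zero by metis
        ultimately show False
          using i not_less_Least[of "i - 1" "\<lambda>i. i \<in> ?U \<and> Suc i \<in> ?U"] by (simp add: i_def[symmetric])
      qed
      then have "potential (?U - {i..Suc (Suc i)}) + 3 \<le> potential ?U"
        using potential_good_move[OF fin i] by simp
      moreover have legal: "Suc i \<in> legal_moves ?G vs"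
        using i undominated_path_subset[of n vs] by (auto simp: legal_path_iff)
      ultimately show ?thesis
        using IH[OF legal] zgame_length_dominator[OF _ dominator(2) legal] dominator(2) by simp
    next
      case staller
      then obtain v where v: "v \<in> legal_moves ?G vs"
        and eq: "zgame_length ?G vs = zgame_length ?G (vs @ [v])"
        using zgame_length_cases[of ?G vs] by auto
      have "Suc (potential (?U - {v - 1..Suc v})) \<le> potential ?U"
        using v fin zero by (intro potential_legal_move) (auto simp: legal_path_iff)
      then show ?thesis
        using IH[OF v] eq staller(2) by simp
    qed
  qed
qed

theorem theorem5p3:
  fixes n :: nat
  assumes "n \<ge> 1"
  shows "\<exists>c::real. \<bar>c\<bar> \<le> 2 \<and> real (gamma_Zg (path_graph n)) = real n / 2 + c"
proof -
  have U: "undominated (path_graph n) [] = {1..n}"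
    by (simp add: undominated_def)
  have "run_ends {1..n} = {n}"
    using assms by (auto simp: run_ends_def)
  then have upper: "2 * gamma_Zg (path_graph n) \<le> n + 1"
    using zgame_length_path_upper[of n "[]"] by (simp add: gamma_Zg_def U potential_def)
  \<comment> \<open>For \<open>n = 1\<close> the undominated vertex has no neighbour to play, but
    the inequality is trivial.\<close>
  have "n \<le> 2 * gamma_Zg (path_graph n) + 1"
    using zgame_length_path_lower[of n "[]"] by (cases "2 \<le> n") (auto simp: gamma_Zg_def U)
  \<comment> \<open>The two bounds even confine the difference to at most 1/2 in absolute
    value.\<close>
  with upper have "\<bar>real (gamma_Zg (path_graph n)) - real n / 2\<bar> \<le> 2"
    by linarith
  then show ?thesis
    by (intro exI[of _ "real (gamma_Zg (path_graph n)) - real n / 2"]) simp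
qed

end
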